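(* Let $k$ be an algebraically closed field of characteristic $2$. There is no pair $(X,S)$ in case (ib) with $X$ a curve over $k$ of genus $g=3$. Consequently, for every pair $(X,S)$ in case (ib), with $X$ of genus $g$, one has $g-1=2^h\ge 4$ for some integer $h$.
   Context: Curves are smooth, projective and irreducible over $k$. The $2$-rank $\gamma(Y)$ of a curve $Y$ is the $\mathbb F_2$-dimension of $\operatorname{Jac}(Y)[2](k)$. A curve of genus $\ge2$ is bielliptic if it has an involution with quotient of genus $1$. Case (ib). Let $X$ be a curve of genus $g\ge 2$ with $2$-rank $\gamma$, and let $S$ be a $2$-subgroup of $\operatorname{Aut}(X)$. Consider the hypotheses: (I) $|S|\ge 8$ and $|S|>2(g-1)$; (II) $S$ fixes no point of $X$ (no point is fixed by all of $S$). A central involution $v\in Z(S)$ is called inductive if $X/\langle v\rangle$ has genus at least $2$ and the induced group $S/\langle v\rangle$, acting on $X/\langle v\rangle$, again satisfies (I) and (II). The pair $(X,S)$ is in case (ib) if $S$ satisfies (I) and (II), $|S|=4(g-1)$, $\gamma=g$, $X$ is bielliptic, and $S=(C_0\times\langle u\rangle)\rtimes\langle w\rangle$, where $C_0$ is cyclic of order $g-1$, $u$ is a central involution, $w$ is an involution, $S/\langle u\rangle$ is dihedral, and $S$ has exactly two central inductive involutions, both contained in $C_0\times\langle u\rangle$. *)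

theory Defs
  imports
    "HOL-Algebra.Elementary_Groups"
    "HOL-Algebra.Bij"
    "HOL-Algebra.Multiplicative_Group"
    "HOL-Analysis.Abstract_Topology"
    "HOL-Library.Function_Algebras"
    "HOL-Computational_Algebra.Polynomial"
begin

section \<open>Spaces with functions\<close>

text \<open>
  Classical varieties over an algebraically closed field are handled as spaces with functions:
  a topological space of closed points with a sheaf of \<open>'k\<close>-valued functions.
  A section over \<open>U\<close> is stored as a total function that is extended by zero outside \<open>U\<close>, so
  that \<open>sections X U\<close> is literally a subset of the \<open>'k\<close>-vector space \<open>'p \<Rightarrow> 'k\<close>.
  Only the values of \<open>sections X\<close> on open sets matter.
\<close>

record ('p, 'k) fun_space =
  zariski :: "'p topology"
  sections :: "'p set \<Rightarrow> ('p \<Rightarrow> 'k) set"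

definition points :: "('p, 'k) fun_space \<Rightarrow> 'p set" where
  "points X = topspace (zariski X)"

definition pull_back ::
  "('p, 'k::zero) fun_space \<Rightarrow> ('p \<Rightarrow> 'q) \<Rightarrow> 'q set \<Rightarrow> ('q \<Rightarrow> 'k) \<Rightarrow> 'p \<Rightarrow> 'k" where
  "pull_back X \<phi> V f = (\<lambda>x. if x \<in> points X \<and> \<phi> x \<in> V then f (\<phi> x) else 0)"

definition morphism ::
  "('p, 'k::zero) fun_space \<Rightarrow> ('q, 'k) fun_space \<Rightarrow> ('p \<Rightarrow> 'q) \<Rightarrow> bool" where
  "morphism X Y \<phi> \<longleftrightarrow>
     continuous_map (zariski X) (zariski Y) \<phi> \<and>
     (\<forall>V. openin (zariski Y) V \<longrightarrow>
        (\<forall>f \<in> sections Y V. pull_back X \<phi> V f \<in> sections X {x \<in> points X. \<phi> x \<in> V}))"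

definition isomorphism ::
  "('p, 'k::zero) fun_space \<Rightarrow> ('q, 'k) fun_space \<Rightarrow> ('p \<Rightarrow> 'q) \<Rightarrow> bool" where
  "isomorphism X Y \<phi> \<longleftrightarrow>
     bij_betw \<phi> (points X) (points Y) \<and> morphism X Y \<phi> \<and>
     morphism Y X (inv_into (points X) \<phi>)"


section \<open>Projective space and its closed subsets\<close>

text \<open>
  Homogeneous coordinates are sequences supported on \<open>{..n}\<close>. Over an infinite field a
  homogeneous polynomial is the same thing as the function it induces.
\<close>

definition form :: "nat \<Rightarrow> nat \<Rightarrow> ((nat \<Rightarrow> 'k::field) \<Rightarrow> 'k) \<Rightarrow> bool" where
  "form n d F \<longleftrightarrow> (\<exists>c :: (nat \<Rightarrow> nat) \<Rightarrow> 'k.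
     F = (\<lambda>x. \<Sum>\<alpha> \<in> {\<alpha>. (\<forall>i>n. \<alpha> i = 0) \<and> (\<Sum>i\<le>n. \<alpha> i) = d}. c \<alpha> * (\<Prod>i\<le>n. x i ^ \<alpha> i)))"

definition proj_points :: "nat \<Rightarrow> (nat \<Rightarrow> 'k::field) set set" where
  "proj_points n =
     {{(\<lambda>i. c * x i) | c. c \<noteq> 0} | x. (\<forall>i>n. x i = 0) \<and> (\<exists>i. x i \<noteq> 0)}"

definition proj_topology :: "nat \<Rightarrow> (nat \<Rightarrow> 'k::field) set topology" where
  "proj_topology n = topology_generated_by
     {{p \<in> proj_points n. \<forall>x \<in> p. F x \<noteq> 0} | d F. form n d F}"

definition proj_subspace ::
  "nat \<Rightarrow> (nat \<Rightarrow> 'k::field) set set \<Rightarrow> ((nat \<Rightarrow> 'k) set, 'k) fun_space" where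
  "proj_subspace n Y = \<lparr>
     zariski = subtopology (proj_topology n) Y,
     sections = (\<lambda>U. {f. (\<forall>p. p \<notin> U \<longrightarrow> f p = 0) \<and>
       (\<forall>p \<in> U. \<exists>V d F G. openin (subtopology (proj_topology n) Y) V \<and> p \<in> V \<and> V \<subseteq> U \<and>
          form n d F \<and> form n d G \<and> (\<forall>q \<in> V. \<forall>x \<in> q. G x \<noteq> 0 \<and> f q = F x / G x))})\<rparr>"


section \<open>Curves\<close>

definition irreducible_closed :: "'p topology \<Rightarrow> 'p set \<Rightarrow> bool" where
  "irreducible_closed T Z \<longleftrightarrow> closedin T Z \<and> Z \<noteq> {} \<and>
     (\<forall>A B. closedin T A \<and> closedin T B \<and> Z \<subseteq> A \<union> B \<longrightarrow> Z \<subseteq> A \<or> Z \<subseteq> B)"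

definition dimension_one :: "'p topology \<Rightarrow> bool" where
  "dimension_one T \<longleftrightarrow>
     (\<exists>Z0 Z1. irreducible_closed T Z0 \<and> irreducible_closed T Z1 \<and> Z0 \<subset> Z1) \<and>
     \<not> (\<exists>Z0 Z1 Z2. irreducible_closed T Z0 \<and> irreducible_closed T Z1 \<and>
           irreducible_closed T Z2 \<and> Z0 \<subset> Z1 \<and> Z1 \<subset> Z2)"

text \<open>
  \<open>uniformizer X P V t\<close>: the germ at \<open>P\<close> of the section \<open>t\<close> over \<open>V\<close> generates the maximal
  ideal of the local ring at \<open>P\<close>. For a local ring of dimension one, such a generator exists
  iff the ring is regular.
\<close>

definition uniformizer ::
  "('p, 'k::field) fun_space \<Rightarrow> 'p \<Rightarrow> 'p set \<Rightarrow> ('p \<Rightarrow> 'k) \<Rightarrow> bool" where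
  "uniformizer X P V t \<longleftrightarrow>
     openin (zariski X) V \<and> P \<in> V \<and> t \<in> sections X V \<and> t P = 0 \<and>
     (\<forall>W g. openin (zariski X) W \<and> P \<in> W \<and> g \<in> sections X W \<and> g P = 0 \<longrightarrow>
        (\<exists>W' h. openin (zariski X) W' \<and> P \<in> W' \<and> W' \<subseteq> V \<inter> W \<and> h \<in> sections X W' \<and>
           (\<forall>x \<in> W'. g x = t x * h x)))"

definition curve :: "('p, 'k::field) fun_space \<Rightarrow> bool" where
  "curve X \<longleftrightarrow>
     (\<forall>U. openin (zariski X) U \<longrightarrow> (\<forall>f \<in> sections X U. \<forall>x. x \<notin> U \<longrightarrow> f x = 0)) \<and>
     (\<exists>n Y \<phi>. closedin (proj_topology n) Y \<and> isomorphism X (proj_subspace n Y) \<phi>) \<and>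
     irreducible_closed (zariski X) (points X) \<and>
     dimension_one (zariski X) \<and>
     (\<forall>P \<in> points X. \<exists>V t. uniformizer X P V t)"


section \<open>Divisors, genus, Jacobian\<close>

text \<open>
  A rational function is given by a section \<open>f\<close> over some nonempty open set; it is
  nonzero iff \<open>f\<close> is not the zero function. The exponent \<open>n\<close> below does not depend on the
  choice of the neighbourhood \<open>V\<close>, because nonempty open subsets of a curve are infinite.
\<close>

definition order_at :: "('p, 'k::field) fun_space \<Rightarrow> 'p \<Rightarrow> ('p \<Rightarrow> 'k) \<Rightarrow> int" where
  "order_at X P f = (THE n. \<exists>V t u. uniformizer X P V t \<and> u \<in> sections X V \<and> u P \<noteq> 0 \<and>
     (\<forall>x \<in> V - {P}. f x = t x powi n * u x))"

definition divisors :: "('p, 'k) fun_space \<Rightarrow> ('p \<Rightarrow> int) set" where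
  "divisors X = {D. finite {P. D P \<noteq> 0} \<and> {P. D P \<noteq> 0} \<subseteq> points X}"

definition degree_div :: "('p \<Rightarrow> int) \<Rightarrow> int" where
  "degree_div D = (\<Sum>P \<in> {P. D P \<noteq> 0}. D P)"

text \<open>
  An element of \<open>L(D)\<close> is regular off the support of \<open>D\<close>, so the Riemann--Roch space can be
  taken inside the sections over the complement of the support.
\<close>

definition riemann_roch_space :: "('p, 'k::field) fun_space \<Rightarrow> ('p \<Rightarrow> int) \<Rightarrow> ('p \<Rightarrow> 'k) set" where
  "riemann_roch_space X D = {f \<in> sections X {P \<in> points X. D P = 0}.
     f = 0 \<or> (\<forall>P \<in> points X. D P \<noteq> 0 \<longrightarrow> order_at X P f \<ge> - D P)}"

definition ell :: "('p, 'k::field) fun_space \<Rightarrow> ('p \<Rightarrow> int) \<Rightarrow> nat" where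
  "ell X D = vector_space.dim (\<lambda>(c :: 'k) f P. c * f P) (riemann_roch_space X D)"

text \<open>
  The genus is the maximum of \<open>deg D + 1 - \<ell>(D)\<close>; it is attained by Riemann's theorem.
\<close>

definition genus :: "('p, 'k::field) fun_space \<Rightarrow> int" where
  "genus X = Sup {degree_div D + 1 - int (ell X D) | D. D \<in> divisors X}"

definition principal_divisors :: "('p, 'k::field) fun_space \<Rightarrow> ('p \<Rightarrow> int) set" where
  "principal_divisors X = {(\<lambda>P. if P \<in> points X then order_at X P f else 0) | U f.
     openin (zariski X) U \<and> U \<noteq> {} \<and> f \<in> sections X U \<and> f \<noteq> 0}"

definition degree_zero_group :: "('p, 'k) fun_space \<Rightarrow> ('p \<Rightarrow> int) monoid" where
  "degree_zero_group X =
     \<lparr>carrier = {D \<in> divisors X. degree_div D = 0}, monoid.mult = (\<lambda>D E. D + E), one = 0\<rparr>"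

text \<open>The \<open>'k\<close>-rational points of the Jacobian.\<close>

definition Jac :: "('p, 'k::field) fun_space \<Rightarrow> ('p \<Rightarrow> int) set monoid" where
  "Jac X = degree_zero_group X Mod principal_divisors X"

definition two_torsion :: "('g, 'm) monoid_scheme \<Rightarrow> 'g set" where
  "two_torsion G = {x \<in> carrier G. x \<otimes>\<^bsub>G\<^esub> x = \<one>\<^bsub>G\<^esub>}"

text \<open>
  A basis of the 2-torsion as a vector space over the field with two elements: linear
  combinations are products over subsets.
\<close>

definition two_torsion_basis :: "('g, 'm) monoid_scheme \<Rightarrow> 'g set \<Rightarrow> bool" where
  "two_torsion_basis G B \<longleftrightarrow> finite B \<and> B \<subseteq> two_torsion G \<and>
     (\<forall>x \<in> two_torsion G. \<exists>!A. A \<subseteq> B \<and> x = finprod G (\<lambda>b. b) A)"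

definition two_rank :: "('p, 'k::field) fun_space \<Rightarrow> nat" where
  "two_rank X = (THE n. \<exists>B. two_torsion_basis (Jac X) B \<and> card B = n)"


section \<open>Automorphisms and quotients\<close>

definition Aut :: "('p, 'k::zero) fun_space \<Rightarrow> ('p \<Rightarrow> 'p) monoid" where
  "Aut X = (BijGroup (points X)) \<lparr>carrier := {\<phi> \<in> Bij (points X). isomorphism X X \<phi>}\<rparr>"

lemma morphism_comp:
  assumes f: "morphism X Y f" and g: "morphism Y Z g" shows "morphism X Z (g \<circ> f)"
proof -
  have cf: "continuous_map (zariski X) (zariski Y) f" and cg: "continuous_map (zariski Y) (zariski Z) g"
    using f g by (auto simp: morphism_def)
  show ?thesis unfolding morphism_def
  proof (intro conjI allI impI ballI)
    show "continuous_map (zariski X) (zariski Z) (g \<circ> f)" using cf cg by (rule continuous_map_compose)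
    fix V s assume V: "openin (zariski Z) V" and s: "s \<in> sections Z V"
    let ?W = "{y \<in> points Y. g y \<in> V}"
    have W: "openin (zariski Y) ?W" using cg V by (simp add: continuous_map_def points_def)
    have "pull_back Y g V s \<in> sections Y ?W" using g V s by (auto simp: morphism_def)
    then have "pull_back X f ?W (pull_back Y g V s) \<in> sections X {x \<in> points X. f x \<in> ?W}"
      using f W by (auto simp: morphism_def)
    moreover have m: "x \<in> points X \<Longrightarrow> f x \<in> points Y" for x
      using cf by (auto simp: continuous_map_def points_def)
    have e1: "pull_back X f ?W (pull_back Y g V s) = pull_back X (g \<circ> f) V s"
      by (auto simp: pull_back_def m fun_eq_iff)
    have e2: "{x \<in> points X. f x \<in> ?W} = {x \<in> points X. (g \<circ> f) x \<in> V}" by (auto simp: m)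
    show "pull_back X (g \<circ> f) V s \<in> sections X {x \<in> points X. (g \<circ> f) x \<in> V}"
      using calculation e1 e2 by simp
  qed
qed

lemma morphism_cong:
  assumes "morphism X Y f" "\<And>x. x \<in> points X \<Longrightarrow> f x = g x" shows "morphism X Y g"
proof -
  have "pull_back X g V s = pull_back X f V s" for V s using assms(2) by (simp add: pull_back_def fun_eq_iff cong: conj_cong)
  moreover have "{x \<in> points X. g x \<in> V} = {x \<in> points X. f x \<in> V}" for V using assms(2) by auto
  moreover have "continuous_map (zariski X) (zariski Y) g"
    using assms by (auto simp: morphism_def points_def intro: continuous_map_eq)
  ultimately show ?thesis using assms(1) by (simp add: morphism_def)
qed

lemma subgroup_Aut:
  assumes "curve X"
  shows "subgroup (carrier (Aut X)) (BijGroup (points X))"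
proof -
  interpret B: group "BijGroup (points X)" by (rule group_BijGroup)
  have idm: "morphism X X (\<lambda>x\<in>points X. x)"
  proof -
    have "morphism X X (\<lambda>x. x)" unfolding morphism_def
    proof (intro conjI allI impI ballI)
      fix V s assume V: "openin (zariski X) V" and s: "s \<in> sections X V"
      have "V \<subseteq> points X" using V openin_subset by (auto simp: points_def)
      moreover have "\<And>x. x \<notin> V \<Longrightarrow> s x = 0" using assms V s by (auto simp: curve_def)
      ultimately have "pull_back X (\<lambda>x. x) V s = s" "{x \<in> points X. x \<in> V} = V"
        by (auto simp: pull_back_def fun_eq_iff)
      then show "pull_back X (\<lambda>x. x) V s \<in> sections X {x \<in> points X. x \<in> V}" using s by simp
    qed auto
    then show ?thesis by (rule morphism_cong) auto
  qed
  show ?thesis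
  proof (rule B.subgroupI)
    show "carrier (Aut X) \<subseteq> carrier (BijGroup (points X))" by (auto simp: Aut_def BijGroup_def)
    have "isomorphism X X (\<lambda>x\<in>points X. x)" unfolding isomorphism_def
    proof (intro conjI)
      show "bij_betw (\<lambda>x\<in>points X. x) (points X) (points X)" by (auto simp: bij_betw_def inj_on_def)
      then have "x \<in> points X \<Longrightarrow> (\<lambda>x\<in>points X. x) x = inv_into (points X) (\<lambda>x\<in>points X. x) x" for x
        by (metis bij_betw_def inv_into_f_f restrict_apply')
      then show "morphism X X (inv_into (points X) (\<lambda>x\<in>points X. x))" by (rule morphism_cong[OF idm])
    qed (rule idm)
    then show "carrier (Aut X) \<noteq> {}" using id_Bij by (auto simp: Aut_def)
  next
    fix a assume a: "a \<in> carrier (Aut X)"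
    let ?i = "restrict (inv_into (points X) a) (points X)"
    have aB: "a \<in> Bij (points X)" and ai: "isomorphism X X a" using a by (auto simp: Aut_def)
    have iB: "?i \<in> Bij (points X)" by (rule restrict_inv_into_Bij[OF aB])
    have inv: "inv\<^bsub>BijGroup (points X)\<^esub> a = ?i" by (rule inv_BijGroup[OF aB])
    have "isomorphism X X ?i" unfolding isomorphism_def
    proof (intro conjI)
      show b: "bij_betw ?i (points X) (points X)" using iB by (simp add: Bij_def)
      show "morphism X X ?i" using ai by (auto simp: isomorphism_def intro: morphism_cong)
      have "a x = inv_into (points X) ?i x" if x: "x \<in> points X" for x
      proof -
        have "a x \<in> points X" "?i (a x) = x" using aB x by (auto simp: Bij_def bij_betw_def)
        then show ?thesis using b by (metis bij_betw_def inv_into_f_f)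
      qed
      then show "morphism X X (inv_into (points X) ?i)"
        using ai by (auto simp: isomorphism_def intro: morphism_cong)
    qed
    then show "inv\<^bsub>BijGroup (points X)\<^esub> a \<in> carrier (Aut X)" using iB inv by (simp add: Aut_def)
  next
    fix a b assume a: "a \<in> carrier (Aut X)" and b: "b \<in> carrier (Aut X)"
    have aB: "a \<in> Bij (points X)" "b \<in> Bij (points X)" and ai: "isomorphism X X a" "isomorphism X X b"
      using a b by (auto simp: Aut_def)
    let ?c = "compose (points X) a b"
    have cB: "?c \<in> Bij (points X)" by (rule compose_Bij[OF aB])
    have "isomorphism X X ?c" unfolding isomorphism_def
    proof (intro conjI)
      show bc: "bij_betw ?c (points X) (points X)" using cB by (simp add: Bij_def)
      show "morphism X X ?c"
        by (rule morphism_cong[OF morphism_comp[of X X b X a]])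
          (use ai in \<open>auto simp: isomorphism_def compose_def\<close>)
      have ba: "bij_betw a (points X) (points X)" and bb: "bij_betw b (points X) (points X)"
        using aB by (auto simp: Bij_def)
      have "(inv_into (points X) b \<circ> inv_into (points X) a) x = inv_into (points X) ?c x" 
        if x: "x \<in> points X" for x
      proof -
        let ?y = "inv_into (points X) b (inv_into (points X) a x)"
        have 1: "inv_into (points X) a x \<in> points X" "a (inv_into (points X) a x) = x"
          using ba x by (auto simp: bij_betw_def inv_into_into f_inv_into_f)
        have 2: "?y \<in> points X" "b ?y = inv_into (points X) a x"
          using bb 1(1) by (auto simp: bij_betw_def inv_into_into f_inv_into_f)
        have "?c ?y = x" using 1 2 by (simp add: compose_def)
        then show ?thesis using bc 2(1) by (metis bij_betw_def inv_into_f_f comp_apply)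
      qed
      then show "morphism X X (inv_into (points X) ?c)"
        by (rule morphism_cong[OF morphism_comp[of X X "inv_into (points X) a" X "inv_into (points X) b"], rotated 2])
          (use ai in \<open>simp_all add: isomorphism_def\<close>)
    qed
    then show "a \<otimes>\<^bsub>BijGroup (points X)\<^esub> b \<in> carrier (Aut X)" using cB aB by (simp add: Aut_def BijGroup_def)
  qed
qed

lemma group_Aut: "curve X \<Longrightarrow> group (Aut X)"
  using group.subgroup_imp_group[OF group_BijGroup subgroup_Aut, of X]
  by (simp add: Aut_def)

text \<open>
  The quotient by a finite group \<open>H\<close> of automorphisms: the orbit space with the quotient
  topology and the functions whose pull-back to \<open>X\<close> is regular.
\<close>

definition orbit_of :: "('p \<Rightarrow> 'p) set \<Rightarrow> 'p \<Rightarrow> 'p set" where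
  "orbit_of H p = (\<lambda>h. h p) ` H"

definition quotient_topology :: "'p topology \<Rightarrow> ('p \<Rightarrow> 'p) set \<Rightarrow> 'p set topology" where
  "quotient_topology T H = topology (\<lambda>U. U \<subseteq> orbit_of H ` topspace T \<and>
     openin T {p \<in> topspace T. orbit_of H p \<in> U})"

lemma openin_quotient_topology:
  "openin (quotient_topology T H) U \<longleftrightarrow> U \<subseteq> orbit_of H ` topspace T \<and>
     openin T {p \<in> topspace T. orbit_of H p \<in> U}"
proof -
  have "istopology (\<lambda>U. U \<subseteq> orbit_of H ` topspace T \<and>
     openin T {p \<in> topspace T. orbit_of H p \<in> U})" (is "istopology ?P")
    unfolding istopology_def
  proof (intro conjI allI impI)
    fix U V assume U: "?P U" and V: "?P V"
    have eq: "{p \<in> topspace T. orbit_of H p \<in> U \<inter> V} =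
      {p \<in> topspace T. orbit_of H p \<in> U} \<inter> {p \<in> topspace T. orbit_of H p \<in> V}" by auto
    show "U \<inter> V \<subseteq> orbit_of H ` topspace T" using U by auto
    show "openin T {p \<in> topspace T. orbit_of H p \<in> U \<inter> V}"
      unfolding eq using U V by (intro openin_Int) auto
  next
    fix \<K> assume K: "\<forall>K \<in> \<K>. ?P K"
    have eq: "{p \<in> topspace T. orbit_of H p \<in> \<Union>\<K>} =
      \<Union> ((\<lambda>K. {p \<in> topspace T. orbit_of H p \<in> K}) ` \<K>)" by auto
    show "\<Union>\<K> \<subseteq> orbit_of H ` topspace T" using K by blast
    show "openin T {p \<in> topspace T. orbit_of H p \<in> \<Union>\<K>}"
      unfolding eq using K by (intro openin_Union) auto
  qed
  then show ?thesis by (simp add: quotient_topology_def)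
qed

definition quotient ::
  "('p, 'k::zero) fun_space \<Rightarrow> ('p \<Rightarrow> 'p) set \<Rightarrow> ('p set, 'k) fun_space" where
  "quotient X H = \<lparr>
     zariski = quotient_topology (zariski X) H,
     sections = (\<lambda>U. {f. (\<forall>q. q \<notin> U \<longrightarrow> f q = 0) \<and>
       pull_back X (orbit_of H) U f \<in> sections X {p \<in> points X. orbit_of H p \<in> U}})\<rparr>"

lemma points_quotient: "points (quotient X H) = orbit_of H ` points X"
proof -
  have "{p \<in> topspace (zariski X). orbit_of H p \<in> orbit_of H ` topspace (zariski X)}
      = topspace (zariski X)" by auto
  then have "openin (quotient_topology (zariski X) H) (orbit_of H ` topspace (zariski X))"
    by (simp add: openin_quotient_topology)
  then show ?thesis
    by (auto simp: points_def quotient_def topspace_def openin_quotient_topology)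
qed

text \<open>The group \<open>S/H\<close>, realised as the group of automorphisms that \<open>S\<close> induces on \<open>X/H\<close>.\<close>

definition induced_group ::
  "('p, 'k::zero) fun_space \<Rightarrow> ('p \<Rightarrow> 'p) set \<Rightarrow> ('p \<Rightarrow> 'p) set \<Rightarrow> ('p set \<Rightarrow> 'p set) set" where
  "induced_group X S H = (\<lambda>s. \<lambda>q \<in> points (quotient X H). s ` q) ` S"

definition involution :: "('g, 'm) monoid_scheme \<Rightarrow> 'g \<Rightarrow> bool" where
  "involution G v \<longleftrightarrow> v \<in> carrier G \<and> v \<noteq> \<one>\<^bsub>G\<^esub> \<and> v \<otimes>\<^bsub>G\<^esub> v = \<one>\<^bsub>G\<^esub>"

definition bielliptic :: "('p, 'k::field) fun_space \<Rightarrow> bool" where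
  "bielliptic X \<longleftrightarrow> curve X \<and> genus X \<ge> 2 \<and>
     (\<exists>v. involution (Aut X) v \<and> genus (quotient X (generate (Aut X) {v})) = 1)"


section \<open>Group-theoretic notions\<close>

definition group_center :: "('g, 'm) monoid_scheme \<Rightarrow> 'g set" where
  "group_center G = {z \<in> carrier G. \<forall>x \<in> carrier G. z \<otimes>\<^bsub>G\<^esub> x = x \<otimes>\<^bsub>G\<^esub> z}"

definition internal_direct_product ::
  "('g, 'm) monoid_scheme \<Rightarrow> 'g set \<Rightarrow> 'g set \<Rightarrow> 'g set \<Rightarrow> bool" where
  "internal_direct_product G N A B \<longleftrightarrow> subgroup A G \<and> subgroup B G \<and>
     (\<forall>a \<in> A. \<forall>b \<in> B. a \<otimes>\<^bsub>G\<^esub> b = b \<otimes>\<^bsub>G\<^esub> a) \<and> A \<inter> B = {\<one>\<^bsub>G\<^esub>} \<and> N = A <#>\<^bsub>G\<^esub> B"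

definition internal_semidirect_product ::
  "('g, 'm) monoid_scheme \<Rightarrow> 'g set \<Rightarrow> 'g set \<Rightarrow> bool" where
  "internal_semidirect_product G N W \<longleftrightarrow> N \<lhd> G \<and> subgroup W G \<and>
     N \<inter> W = {\<one>\<^bsub>G\<^esub>} \<and> carrier G = N <#>\<^bsub>G\<^esub> W"

text \<open>Dihedral groups of order \<open>2 m\<close> with \<open>m \<ge> 2\<close>; the Klein four-group is included.\<close>

definition dihedral :: "('g, 'm) monoid_scheme \<Rightarrow> bool" where
  "dihedral G \<longleftrightarrow> group G \<and>
     (\<exists>m \<ge> 2. \<exists>r \<in> carrier G. \<exists>s \<in> carrier G.
        group.ord G r = m \<and> card (carrier G) = 2 * m \<and> s \<notin> generate G {r} \<and>
        s \<otimes>\<^bsub>G\<^esub> s = \<one>\<^bsub>G\<^esub> \<and> s \<otimes>\<^bsub>G\<^esub> r \<otimes>\<^bsub>G\<^esub> s = inv\<^bsub>G\<^esub> r)"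


section \<open>Case (ib)\<close>

definition hypothesis_I :: "('p, 'k::field) fun_space \<Rightarrow> ('p \<Rightarrow> 'p) set \<Rightarrow> bool" where
  "hypothesis_I X S \<longleftrightarrow> card S \<ge> 8 \<and> int (card S) > 2 * (genus X - 1)"

definition hypothesis_II :: "('p, 'k::field) fun_space \<Rightarrow> ('p \<Rightarrow> 'p) set \<Rightarrow> bool" where
  "hypothesis_II X S \<longleftrightarrow> \<not> (\<exists>P \<in> points X. \<forall>s \<in> S. s P = P)"

definition group_on :: "('p, 'k::field) fun_space \<Rightarrow> ('p \<Rightarrow> 'p) set \<Rightarrow> ('p \<Rightarrow> 'p) monoid" where
  "group_on X S = (Aut X) \<lparr>carrier := S\<rparr>"

definition central_inductive_involution ::
  "('p, 'k::field) fun_space \<Rightarrow> ('p \<Rightarrow> 'p) set \<Rightarrow> ('p \<Rightarrow> 'p) \<Rightarrow> bool" where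
  "central_inductive_involution X S v \<longleftrightarrow>
     v \<in> group_center (group_on X S) \<and> involution (group_on X S) v \<and>
     (let H = generate (group_on X S) {v} in
        genus (quotient X H) \<ge> 2 \<and>
        hypothesis_I (quotient X H) (induced_group X S H) \<and>
        hypothesis_II (quotient X H) (induced_group X S H))"

definition case_ib :: "('p, 'k::field) fun_space \<Rightarrow> ('p \<Rightarrow> 'p) set \<Rightarrow> bool" where
  "case_ib X S \<longleftrightarrow>
     curve X \<and> genus X \<ge> 2 \<and>
     subgroup S (Aut X) \<and> (\<exists>n. card S = 2 ^ n) \<and>
     hypothesis_I X S \<and> hypothesis_II X S \<and>
     int (card S) = 4 * (genus X - 1) \<and>
     int (two_rank X) = genus X \<and>
     bielliptic X \<and>
     (\<exists>C0 u w N.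
        subgroup C0 (group_on X S) \<and> cyclic_group ((group_on X S)\<lparr>carrier := C0\<rparr>) \<and>
        int (card C0) = genus X - 1 \<and>
        u \<in> group_center (group_on X S) \<and> involution (group_on X S) u \<and>
        involution (group_on X S) w \<and>
        internal_direct_product (group_on X S) N C0 (generate (group_on X S) {u}) \<and>
        internal_semidirect_product (group_on X S) N (generate (group_on X S) {w}) \<and>
        dihedral (group_on X S Mod generate (group_on X S) {u}) \<and>
        card {v. central_inductive_involution X S v} = 2 \<and>
        {v. central_inductive_involution X S v} \<subseteq> N)"

end

theory Submission
  imports Defs
begin

text \<open>
  A nontrivial subgroup acts trivially on its own orbit space, so the group induced by \<open>S\<close> on
  \<open>X/\<langle>v\<rangle>\<close> is strictly smaller than \<open>S\<close>. For \<open>g = 3\<close> we have \<open>|S| = 4 (g - 1) = 8\<close>, hence the induced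
  group cannot satisfy the bound \<open>\<ge> 8\<close> of hypothesis (I), and no central involution is inductive.
  In general \<open>g - 1 = |S| / 4\<close> is a power of two, at least \<open>2\<close>, and the value \<open>2\<close> is excluded.
\<close>

text \<open>Left multiplication by \<open>v\<close> permutes the group \<open>H\<close>, so it only
  reorders the points \<open>h p\<close> of an orbit. Hence \<open>H\<close> acts trivially on its
  own orbit space.\<close>

lemma image_orbit_of:
  assumes H: "subgroup H (BijGroup A)" and v: "v \<in> H" and p: "p \<in> A"
  shows "v ` orbit_of H p = orbit_of H p"
proof -
  interpret B: group "BijGroup A" by (rule group_BijGroup)
  interpret H: subgroup H "BijGroup A" by (rule H)
  have mult: "(a \<otimes>\<^bsub>BijGroup A\<^esub> b) p = a (b p)" if "a \<in> H" "b \<in> H" for a b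
    using H.mem_carrier[OF that(1)] H.mem_carrier[OF that(2)] p
    by (simp add: BijGroup_def compose_def)
  show ?thesis
  proof (intro equalityI subsetI)
    fix x assume "x \<in> v ` orbit_of H p"
    then obtain h where h: "h \<in> H" "x = v (h p)" by (auto simp: orbit_of_def)
    then have "x = (v \<otimes>\<^bsub>BijGroup A\<^esub> h) p" using mult v by simp
    then show "x \<in> orbit_of H p" using h v by (auto simp: orbit_of_def)
  next
    fix x assume "x \<in> orbit_of H p"
    then obtain h where h: "h \<in> H" "x = h p" by (auto simp: orbit_of_def)
    \<comment> \<open>The preimage of \<open>h\<close> under left multiplication by
      \<open>v\<close>.\<close>
    let ?h = "inv\<^bsub>BijGroup A\<^esub> v \<otimes>\<^bsub>BijGroup A\<^esub> h"
    have "?h \<in> H" using h v by simp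
    moreover have "v \<otimes>\<^bsub>BijGroup A\<^esub> ?h = h"
      using H.mem_carrier[OF h(1)] H.mem_carrier[OF v] by (simp add: B.m_assoc[symmetric])
    ultimately have "x = v (?h p)" using h mult[OF v, of ?h] by simp
    then show "x \<in> v ` orbit_of H p" using \<open>?h \<in> H\<close> by (auto simp: orbit_of_def)
  qed
qed

text \<open>The induced group is the image of \<open>S\<close> under
  \<open>s \<mapsto> ?f s\<close>, and this map identifies \<open>v\<close> with the identity, two
  distinct elements of \<open>S\<close>.\<close>

lemma card_induced_group_less:
  fixes X :: "('p, 'k::field) fun_space"
  assumes X: "curve X" and S: "subgroup S (Aut X)" and fin: "finite S"
    and H: "subgroup H (group_on X S)" and v: "v \<in> H" "v \<noteq> \<one>\<^bsub>group_on X S\<^esub>"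
  shows "card (induced_group X S H) < card S"
proof -
  let ?f = "\<lambda>s. \<lambda>q \<in> points (quotient X H). s ` q"
  let ?e = "\<one>\<^bsub>group_on X S\<^esub>"
  have HA: "subgroup H (Aut X)"
    using group.incl_subgroup[OF group_Aut[OF X] S] H by (simp add: group_on_def)
  \<comment> \<open>\<open>Aut X\<close> is \<open>BijGroup (points X)\<close> with a smaller
    carrier; this form lets \<open>H\<close> be viewed as a group of bijections, as the orbit lemma
    requires.\<close>
  have "Aut X = (BijGroup (points X))\<lparr>carrier := carrier (Aut X)\<rparr>" by (simp add: Aut_def)
  then have HB: "subgroup H (BijGroup (points X))"
    using group.incl_subgroup[OF group_BijGroup subgroup_Aut[OF X]] HA by metis
  have HS: "H \<subseteq> S" using subgroup.subset[OF H] by (simp add: group_on_def)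
  have e: "?e \<in> H" using subgroup.one_closed[OF H] .
  have "?f v = ?f ?e"
  proof (rule restrict_ext)
    fix q assume "q \<in> points (quotient X H)"
    then obtain p where "p \<in> points X" "q = orbit_of H p" by (auto simp: points_quotient)
    then show "v ` q = ?e ` q"
      by (simp only: image_orbit_of[OF HB v(1)] image_orbit_of[OF HB e])
  qed
  then have "\<not> inj_on ?f S" using v e HS by (auto dest: inj_onD)
  then have "card (?f ` S) \<noteq> card S" using fin eq_card_imp_inj_on by blast
  then show ?thesis
    using card_image_le[OF fin, of ?f] by (simp add: induced_group_def)
qed

text \<open>Hypothesis (I) on the quotient by the group generated by \<open>v\<close> asks for at
  least 8 induced automorphisms, and \<open>S\<close> has strictly more elements than that induced
  group.\<close>

lemma central_inductive_involution_card:
  fixes X :: "('p, 'k::field) fun_space"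
  assumes "curve X" and S: "subgroup S (Aut X)" and "finite S"
    and v: "central_inductive_involution X S v"
  shows "card S > 8"
proof -
  let ?H = "generate (group_on X S) {v}"
  have grp: "group (group_on X S)"
    unfolding group_on_def using group.subgroup_imp_group[OF group_Aut S] assms(1) .
  have inv: "involution (group_on X S) v"
    and I: "hypothesis_I (quotient X ?H) (induced_group X S ?H)"
    using v by (auto simp: central_inductive_involution_def Let_def)
  have "subgroup ?H (group_on X S)"
    using inv by (intro group.generate_is_subgroup[OF grp]) (auto simp: involution_def)
  moreover have "v \<in> ?H" by (rule generate.incl) simp
  ultimately have "card (induced_group X S ?H) < card S"
    using inv assms by (intro card_induced_group_less) (auto simp: involution_def)
  then show ?thesis using I by (simp add: hypothesis_I_def)
qed

lemma case_ib_genus: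
  fixes X :: "('p, 'k::field) fun_space"
  assumes "case_ib X S"
  shows "genus X \<noteq> 3"
proof -
  have X: "curve X" and S: "subgroup S (Aut X)" and I: "hypothesis_I X S"
    and cS: "int (card S) = 4 * (genus X - 1)"
    and two: "card {v. central_inductive_involution X S v} = 2"
    using assms by (auto simp: case_ib_def)
  \<comment> \<open>An infinite set has \<open>card\<close> equal to 0, so the bound
    \<open>card S \<ge> 8\<close> forces finiteness.\<close>
  have "finite S" using I by (intro card_ge_0_finite) (simp add: hypothesis_I_def)
  moreover from two have "{v. central_inductive_involution X S v} \<noteq> {}"
    by (metis card.empty zero_neq_numeral)
  then obtain v where "central_inductive_involution X S v" by blast
  ultimately have "card S > 8" using central_inductive_involution_card X S by blast
  then show ?thesis using cS by simp
qed

theorem proposition1p4: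
  assumes "CHAR('k::alg_closed_field) = 2"
  shows "\<not> (\<exists>(X :: ('p, 'k) fun_space) S. case_ib X S \<and> genus X = 3) \<and>
    (\<forall>(X :: ('p, 'k) fun_space) S. case_ib X S \<longrightarrow>
       (\<exists>h::nat. genus X - 1 = 2 ^ h \<and> (2::int) ^ h \<ge> 4))"
proof (intro conjI allI impI)
  show "\<not> (\<exists>(X :: ('p, 'k) fun_space) S. case_ib X S \<and> genus X = 3)"
    using case_ib_genus by blast
next
  fix X :: "('p, 'k) fun_space" and S
  assume ib: "case_ib X S"
  obtain n where n: "card S = 2 ^ n" "card S \<ge> 8" "int (card S) = 4 * (genus X - 1)"
    using ib by (auto simp: case_ib_def hypothesis_I_def)
  have "genus X \<noteq> 3" using case_ib_genus[OF ib] .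
  \<comment> \<open>Order 8 would give \<open>4 * (genus X - 1) = 8\<close>, that is, genus
    3.\<close>
  then have "card S \<noteq> 8" using n(3) by auto
  then have "(2::nat) ^ 3 < 2 ^ n" using n(1,2) by simp
  then have "3 < n" by (rule power_less_imp_less_exp[rotated]) simp
  \<comment> \<open>Dividing \<open>2 ^ (m + 4)\<close> by 4 leaves the exponent
    \<open>h = m + 2\<close>, which is at least 2.\<close>
  then obtain m where "n = m + 4" using le_Suc_ex[of 4 n] by auto
  then have "genus X - 1 = 2 ^ (m + 2)" using n by (simp add: power_add)
  moreover have "(2::int) ^ (m + 2) \<ge> 4" by (simp add: power_add)
  ultimately show "\<exists>h::nat. genus X - 1 = 2 ^ h \<and> (2::int) ^ h \<ge> 4" by blast
qed

end
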